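(* Let $\mathcal{C}$ be an $n$-step staircase with maximum point $(x_{\max},y_{\max},z_{\max})$ (the coordinatewise maxima over $\mathcal{C}$). Let $\mathcal{B}_Z$, $\mathcal{B}_X$, $\mathcal{B}_Y$ be the sequences returned by the boundary tracing algorithm started at $(x_{\max},y_{\max},z_{\max})$ with search orders $(x,y,z)$, $(y,z,x)$, $(z,x,y)$ respectively. Then $\mathcal{C}=\mathcal{B}_X\vee\mathcal{B}_Y\vee\mathcal{B}_Z:=\{A_1\cup A_2\cup A_3: A_1\in\mathcal{B}_X,\ A_2\in\mathcal{B}_Y,\ A_3\in\mathcal{B}_Z\}$.
   Context: Points of $\mathbb{Z}^3$ are regarded as multisets over $\{x,y,z\}$; $A\cup B$ is the coordinatewise maximum. A digital cuboid is a set $C=\{(x,y,z)\in\mathbb{Z}^3: x_{\min}\le x\le x_{\max},\ y_{\min}\le y\le y_{\max},\ z_{\min}\le z\le z_{\max}\}$ with $|C|>1$. A sequence of cuboids $C_1,\dots,C_n$ (with parameters $x^i_{\min},x^i_{\max}$, etc.) is regular if (a) $x^1_{\min}=y^1_{\min}=z^1_{\min}=0$; (b) for each $1\le i\le n-1$: $x^i_{\min}\le x^{i+1}_{\min}$, $y^i_{\min}\le y^{i+1}_{\min}$, $z^i_{\min}\le z^{i+1}_{\min}$, at least one strict; (c) for each $1\le i\le n-1$: $x^{i+1}_{\min}\le x^i_{\max}$, $y^{i+1}_{\min}\le y^i_{\max}$, $z^{i+1}_{\min}\le z^i_{\max}$; (d) for each $1\le i\le n-1$: $x^i_{\max}\le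 x^{i+1}_{\max}$, $y^i_{\max}\le y^{i+1}_{\max}$, $z^i_{\max}\le z^{i+1}_{\max}$, at least one strict. The union $\mathcal{C}=C_1\cup\dots\cup C_n$ of a regular sequence is an $n$-step staircase. Boundary tracing algorithm with search order $(u,v,w)$ (a permutation of the coordinates $x,y,z$) started at a point $P\in\mathcal{C}$: set the current point to $P$ and record it as $B_0$; repeat: if decreasing coordinate $u$ by $1$ gives a point of $\mathcal{C}$, decrease $u$; else if decreasing $v$ by $1$ gives a point of $\mathcal{C}$, decrease $v$; else decrease $w$ by $1$; record the new point as $B_{i}$ (with $i$ incremented); stop when $B_i=(0,0,0)$. The output is the sequence $B_i,B_{i-1},\dots,B_0$. *)

theory Defs
  imports Main "HOL-Library.While_Combinator"
begin

datatype axis = X | Y | Z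

text \<open>
  Points of \<open>\<int>\<^sup>3\<close>. On this type the library operation \<^const>\<open>sup\<close> is the coordinatewise
  maximum, i.e. the union of points regarded as multisets.
\<close>
type_synonym point = "axis \<Rightarrow> int"

abbreviation origin :: point where
  "origin \<equiv> (\<lambda>_. 0)"

definition cuboid :: "point \<Rightarrow> point \<Rightarrow> point set" where
  "cuboid lo hi = {p. \<forall>c. lo c \<le> p c \<and> p c \<le> hi c}"

text \<open>
  The sequence is indexed by \<open>1, \<dots>, n\<close>; the values of \<open>lo\<close> and \<open>hi\<close> at other indices are
  irrelevant. Cuboids are finite, so the condition on \<^const>\<open>card\<close> says exactly that each of
  them has more than one point.
\<close>
definition regular :: "nat \<Rightarrow> (nat \<Rightarrow> point) \<Rightarrow> (nat \<Rightarrow> point) \<Rightarrow> bool" where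
  "regular n lo hi \<longleftrightarrow>
     1 \<le> n \<and>
     (\<forall>i\<in>{1..n}. card (cuboid (lo i) (hi i)) > 1) \<and>
     (\<forall>c. lo 1 c = 0) \<and>
     (\<forall>i\<in>{1..<n}. (\<forall>c. lo i c \<le> lo (i + 1) c) \<and> (\<exists>c. lo i c < lo (i + 1) c)) \<and>
     (\<forall>i\<in>{1..<n}. \<forall>c. lo (i + 1) c \<le> hi i c) \<and>
     (\<forall>i\<in>{1..<n}. (\<forall>c. hi i c \<le> hi (i + 1) c) \<and> (\<exists>c. hi i c < hi (i + 1) c))"

definition staircase :: "nat \<Rightarrow> point set \<Rightarrow> bool" where
  "staircase n C \<longleftrightarrow>
     (\<exists>lo hi. regular n lo hi \<and> C = (\<Union>i\<in>{1..n}. cuboid (lo i) (hi i)))"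

definition max_point :: "point set \<Rightarrow> point" where
  "max_point C = (\<lambda>c. Max ((\<lambda>p. p c) ` C))"

definition decrease :: "axis \<Rightarrow> point \<Rightarrow> point" where
  "decrease c p = p(c := p c - 1)"

definition trace_step :: "point set \<Rightarrow> axis \<Rightarrow> axis \<Rightarrow> axis \<Rightarrow> point \<Rightarrow> point" where
  "trace_step C u v w p =
     (if decrease u p \<in> C then decrease u p
      else if decrease v p \<in> C then decrease v p
      else decrease w p)"

text \<open>
  The loop state is the current point together with the points recorded so far, most recent
  first; the final list is therefore already \<open>B\<^sub>i, B\<^sub>i\<^sub>-\<^sub>1, \<dots>, B\<^sub>0\<close>. The result is \<^const>\<open>None\<close>
  iff the loop does not terminate.
\<close>
definition boundary_trace ::
    "point set \<Rightarrow> axis \<Rightarrow> axis \<Rightarrow> axis \<Rightarrow> point \<Rightarrow> point list option" where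
  "boundary_trace C u v w P =
     map_option snd
       (while_option
          (\<lambda>(p, Bs). p \<noteq> origin)
          (\<lambda>(p, Bs). let q = trace_step C u v w p in (q, q # Bs))
          (P, [P]))"

definition join3 :: "point list \<Rightarrow> point list \<Rightarrow> point list \<Rightarrow> point set" where
  "join3 As Bs Cs =
     {sup (sup A1 A2) A3 | A1 A2 A3. A1 \<in> set As \<and> A2 \<in> set Bs \<and> A3 \<in> set Cs}"

end

theory Submission
  imports Defs
begin

text \<open>
  A staircase \<open>C\<close> is closed under coordinatewise minima and maxima, and whenever \<open>q \<le> p\<close> are
  distinct points of \<open>C\<close>, one can move one step from \<open>p\<close> towards \<open>q\<close> inside \<open>C\<close>. Hence the trace
  with search order \<open>(u, v, w)\<close> stays in \<open>C\<close> and reaches the origin. It takes every value of the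
  coordinate \<open>w\<close>, and the last point \<open>A\<close> at a given level of \<open>w\<close> lies below every point \<open>q\<close> of \<open>C\<close>
  at that level: otherwise a step from \<open>A\<close> towards \<open>inf A q\<close> decreases \<open>u\<close> or \<open>v\<close> inside \<open>C\<close>.
  So every \<open>q \<in> C\<close> is the join of three trace points below \<open>q\<close>, each sharing one coordinate with it.
\<close>

section \<open>Monotonicity of the corners along a regular sequence\<close>

lemma regular_mono:
  assumes reg: "regular n lo hi" and "1 \<le> i" "i \<le> j" "j \<le> n"
  shows "lo i \<le> lo j" and "hi i \<le> hi j"
proof -
  have "j \<le> n \<longrightarrow> lo i \<le> lo j \<and> hi i \<le> hi j"
    using \<open>i \<le> j\<close>
  proof (induction j rule: dec_induct)
    case base
    show ?case by simp
  next
    case (step k)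
    show ?case
    proof
      assume k: "Suc k \<le> n"
      then have "k \<in> {1..<n}"
        using step.hyps \<open>1 \<le> i\<close> by simp
      then have "lo k \<le> lo (k + 1)" "hi k \<le> hi (k + 1)"
        using reg unfolding regular_def le_fun_def by blast+
      then show "lo i \<le> lo (Suc k) \<and> hi i \<le> hi (Suc k)"
        using step.IH k by (auto intro: order_trans)
    qed
  qed
  then show "lo i \<le> lo j" "hi i \<le> hi j"
    using \<open>j \<le> n\<close> by auto
qed

lemma mem_cuboid_iff: "p \<in> cuboid lo hi \<longleftrightarrow> lo \<le> p \<and> p \<le> hi"
  by (auto simp: cuboid_def le_fun_def)

lemma regular_lo_le_hi:
  assumes "regular n lo hi" "i \<in> {1..n}"
  shows "lo i \<le> hi i"
proof -
  have "card (cuboid (lo i) (hi i)) > 1"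
    using assms unfolding regular_def by blast
  then have "cuboid (lo i) (hi i) \<noteq> {}"
    by auto
  then show ?thesis
    by (auto simp: mem_cuboid_iff intro: order_trans)
qed

section \<open>The staircase as a lattice with a least and a greatest point\<close>

locale regular_sequence =
  fixes n :: nat and lo hi :: "nat \<Rightarrow> point" and C :: "point set"
  assumes reg: "regular n lo hi"
    and C_eq: "C = (\<Union>i\<in>{1..n}. cuboid (lo i) (hi i))"
begin

lemma n_pos: "1 \<le> n"
  using reg by (simp add: regular_def)

lemma lo_1: "lo 1 = origin"
  using reg by (auto simp: regular_def)

lemma mem_iff: "p \<in> C \<longleftrightarrow> (\<exists>i. 1 \<le> i \<and> i \<le> n \<and> lo i \<le> p \<and> p \<le> hi i)"
  by (auto simp: C_eq mem_cuboid_iff)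

text \<open>Both corners increase with the index, so the infimum falls into the earlier cuboid and
  the supremum into the later one.\<close>

lemma lattice_closed_ordered:
  assumes "1 \<le> i" "i \<le> j" "j \<le> n" "lo i \<le> p" "p \<le> hi i" "lo j \<le> q" "q \<le> hi j"
  shows "inf p q \<in> C" "sup p q \<in> C"
proof -
  have "lo i \<le> q" "p \<le> hi j"
    using regular_mono[OF reg assms(1-3)] assms by (blast intro: order_trans)+
  then have "lo i \<le> inf p q" "inf p q \<le> hi i" "lo j \<le> sup p q" "sup p q \<le> hi j"
    using assms by (auto intro: le_infI1 le_supI2)
  moreover have "i \<le> n" "1 \<le> j"
    using assms by auto
  ultimately show "inf p q \<in> C" "sup p q \<in> C"
    unfolding mem_iff using assms by blast+
qed

lemma lattice_closed:
  assumes "p \<in> C" "q \<in> C"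
  shows "inf p q \<in> C" "sup p q \<in> C"
proof -
  obtain i j where ij: "1 \<le> i" "i \<le> n" "lo i \<le> p" "p \<le> hi i"
      "1 \<le> j" "j \<le> n" "lo j \<le> q" "q \<le> hi j"
    using assms unfolding mem_iff by blast
  have "inf p q \<in> C \<and> sup p q \<in> C"
  proof (cases "i \<le> j")
    case True
    then show ?thesis using ij lattice_closed_ordered[of i j p q] by blast
  next
    case False
    then show ?thesis
      using ij lattice_closed_ordered[of j i q p] by (simp add: inf_commute sup_commute)
  qed
  then show "inf p q \<in> C" "sup p q \<in> C" by auto
qed

lemma origin_mem: "origin \<in> C"
  using n_pos regular_lo_le_hi[OF reg, of 1] lo_1 unfolding mem_iff by auto

lemma origin_le: "p \<in> C \<Longrightarrow> origin \<le> p"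
  using regular_mono(1)[OF reg, of 1] lo_1 unfolding mem_iff by (metis order.refl order_trans)

lemma hi_n_mem: "hi n \<in> C"
  using n_pos regular_lo_le_hi[OF reg, of n] unfolding mem_iff by auto

lemma le_hi_n: "p \<in> C \<Longrightarrow> p \<le> hi n"
  using regular_mono(2)[OF reg, of _ n] unfolding mem_iff by (metis order.refl order_trans)

text \<open>Coordinatewise maxima of a set need not be attained at a single point. Here the top
  corner of the last cuboid attains all of them, so the trace starts inside
  \<open>C\<close>.\<close>

lemma max_point_eq: "max_point C = hi n"
proof
  fix c
  have sub: "(\<lambda>p. p c) ` C \<subseteq> {0..hi n c}"
    using le_hi_n origin_le by (force simp: le_fun_def)
  show "max_point C c = hi n c"
    unfolding max_point_def
  proof (rule Max_eqI)
    show "finite ((\<lambda>p. p c) ` C)"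
      using sub finite_subset by blast
  qed (use sub hi_n_mem in auto)
qed

lemma max_point_mem: "max_point C \<in> C"
  by (simp add: max_point_eq hi_n_mem)

lemma le_max_point: "p \<in> C \<Longrightarrow> p \<le> max_point C"
  by (simp add: max_point_eq le_hi_n)

section \<open>Descent inside the staircase\<close>

text \<open>In the first cuboid containing \<open>p\<close>, some coordinate to be decreased lies
  above the lower corner. Otherwise the overlap of consecutive cuboids would put \<open>p\<close>
  into the preceding cuboid as well.\<close>

lemma descent:
  assumes p: "p \<in> C" and q: "q \<in> C" and le: "q \<le> p" and neq: "q \<noteq> p"
  obtains c where "q c < p c" "decrease c p \<in> C"
proof -
  define Q where "Q j \<longleftrightarrow> 1 \<le> j \<and> j \<le> n \<and> lo j \<le> p \<and> p \<le> hi j" for j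
  define j where "j = (LEAST j. Q j)"
  have "\<exists>j. Q j"
    using p unfolding mem_iff Q_def by blast
  then have "Q j"
    unfolding j_def by (rule LeastI_ex)
  then have j: "1 \<le> j" "j \<le> n" "lo j \<le> p" "p \<le> hi j"
    by (auto simp: Q_def)
  have least: "\<not> Q k" if "k < j" for k
    using that unfolding j_def by (rule not_less_Least)
  have "\<exists>c. q c < p c \<and> lo j c < p c"
  proof (rule ccontr)
    assume "\<nexists>c. q c < p c \<and> lo j c < p c"
    then have stuck: "p c = lo j c" if "q c < p c" for c
      using that j(3) by (metis le_funD order.not_eq_order_implies_strict)
    obtain d where d: "q d < p d"
      using le neq by (metis ext le_funD order.not_eq_order_implies_strict)
    obtain i where i: "1 \<le> i" "i \<le> n" "lo i \<le> q" "q \<le> hi i"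
      using q unfolding mem_iff by blast
    \<comment> \<open>If \<open>j \<le> i\<close>, then \<open>lo j \<le> lo i \<le> q\<close>,
      which contradicts \<open>q d < p d = lo j d\<close>.\<close>
    have "i < j"
    proof (rule ccontr)
      assume "\<not> i < j"
      then have "lo j \<le> q"
        using regular_mono(1)[OF reg, of j i] i j by (auto intro: order_trans)
      then show False
        using stuck[OF d] d by (auto simp: le_fun_def dest: spec[of _ d])
    qed
    define k where "k = j - 1"
    have k: "1 \<le> k" "k < j" "i \<le> k" "k \<le> n" "k \<in> {1..<n}" "k + 1 = j"
      using \<open>i < j\<close> i j by (auto simp: k_def)
    have "lo k \<le> p"
      using regular_mono(1)[OF reg, of k j] k j by (auto intro: order_trans)
    \<comment> \<open>Where \<open>q c < p c\<close>, the value \<open>p c = lo (k + 1) c\<close> is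
      bounded by the overlap condition; elsewhere
      \<open>p c \<le> q c \<le> hi i c \<le> hi k c\<close>.\<close>
    moreover have "p c \<le> hi k c" for c
    proof (cases "q c < p c")
      case True
      have "lo (k + 1) c \<le> hi k c"
        using reg k(5) unfolding regular_def by blast
      then show ?thesis
        using stuck[OF True] k(6) by simp
    next
      case False
      have "q c \<le> hi k c"
        using i(4) regular_mono(2)[OF reg i(1) k(3,4)] by (meson le_funD order_trans)
      then show ?thesis
        using False by simp
    qed
    ultimately have "Q k"
      using k by (auto simp: Q_def le_fun_def)
    then show False
      using least k by blast
  qed
  then obtain c where c: "q c < p c" "lo j c < p c"
    by blast
  have "lo j \<le> decrease c p" "decrease c p \<le> hi j"
    using j(3,4) c(2) by (auto simp: decrease_def le_fun_def intro: order_trans[of _ "p c"])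
  then have "decrease c p \<in> C"
    using j unfolding mem_iff by blast
  then show thesis
    using c that by blast
qed

section \<open>Steps and levels of the boundary trace\<close>

text \<open>The last branch of the algorithm decreases \<open>w\<close> without testing membership.
  Descent towards the origin makes some decrease possible, so it must be that of \<open>w\<close>
  when \<open>u\<close> and \<open>v\<close> are blocked.\<close>

lemma trace_step_cases:
  assumes axes: "{u, v, w} = UNIV" and p: "p \<in> C" "p \<noteq> origin"
  obtains (minor) c where "c \<in> {u, v}" "trace_step C u v w p = decrease c p" "decrease c p \<in> C"
    | (major) "decrease u p \<notin> C" "decrease v p \<notin> C"
        "trace_step C u v w p = decrease w p" "decrease w p \<in> C"
proof -
  obtain c where c: "decrease c p \<in> C"
    using descent[OF p(1) origin_mem origin_le[OF p(1)]] p(2) by metis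
  have "c \<in> {u, v, w}"
    using axes by simp
  then show thesis
    using c minor[of u] minor[of v] major unfolding trace_step_def by (metis insert_iff singletonD)
qed

text \<open>Otherwise descent towards \<open>inf p q\<close> applies. It cannot use
  \<open>w\<close>, where \<open>inf p q\<close> agrees with \<open>p\<close>, so it needs one of
  the blocked axes.\<close>

lemma stuck_point_le:
  assumes axes: "{u, v, w} = UNIV" and p: "p \<in> C" and q: "q \<in> C" "q w = p w"
    and stuck: "decrease u p \<notin> C" "decrease v p \<notin> C"
  shows "p \<le> q"
proof (rule ccontr)
  assume "\<not> p \<le> q"
  then have "inf p q \<noteq> p"
    by (metis inf.cobounded2)
  then obtain c where c: "inf p q c < p c" "decrease c p \<in> C"
    using descent[OF p lattice_closed(1)[OF p q(1)]] by auto
  have "c \<in> {u, v, w}"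
    using axes by simp
  moreover have "c \<noteq> w"
    using c(1) q(2) by auto
  ultimately show False
    using c(2) stuck by auto
qed

lemma boundary_trace_level_points:
  assumes axes: "{u, v, w} = UNIV" "w \<noteq> u" "w \<noteq> v"
  obtains Bs where "boundary_trace C u v w (max_point C) = Some Bs" "set Bs \<subseteq> C"
    "\<And>q. q \<in> C \<Longrightarrow> \<exists>A\<in>set Bs. A w = q w \<and> A \<le> q"
proof -
  \<comment> \<open>Only levels of \<open>w\<close> strictly above the current one are claimed to be
    settled, since the trace may still move within the current level.\<close>
  define Inv where "Inv s \<longleftrightarrow> (case s of (p, Bs) \<Rightarrow> p \<in> C \<and> set Bs \<subseteq> C \<and> p \<in> set Bs \<and>
      (\<forall>q\<in>C. p w < q w \<longrightarrow> (\<exists>A\<in>set Bs. A w = q w \<and> A \<le> q)))"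
    for s :: "point \<times> point list"
  define f where "f s = nat (fst s X + fst s Y + fst s Z)" for s :: "point \<times> point list"
  let ?b = "\<lambda>(p, Bs). p \<noteq> origin"
  let ?c = "\<lambda>(p, Bs). let q = trace_step C u v w p in (q, q # Bs)"
  \<comment> \<open>The decreased point has nonnegative coordinates, so \<open>nat\<close> truncates
    neither sum and the drop is strict.\<close>
  have measure: "f (decrease c p, Bs') < f (p, Bs)" if "decrease c p \<in> C" for c p Bs Bs'
  proof -
    have "0 \<le> decrease c p a" for a
      using origin_le[OF that] by (simp add: le_fun_def)
    from this[of X] this[of Y] this[of Z] show ?thesis
      by (cases c) (auto simp: f_def decrease_def)
  qed
  \<comment> \<open>At the maximum point no higher level exists, so the claim is vacuous.\<close>
  have init: "Inv (max_point C, [max_point C])"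
    using max_point_mem le_funD[OF le_max_point, of _ w] by (auto simp: Inv_def not_less[symmetric])
  have step: "Inv (?c s) \<and> f (?c s) < f s" if "Inv s" "?b s" for s
  proof -
    obtain p Bs where s: "s = (p, Bs)"
      by (cases s)
    have p: "p \<in> C" "p \<noteq> origin" and Bs: "set Bs \<subseteq> C" "p \<in> set Bs"
      and hit: "\<And>q. q \<in> C \<Longrightarrow> p w < q w \<Longrightarrow> \<exists>A\<in>set Bs. A w = q w \<and> A \<le> q"
      using \<open>Inv s\<close> \<open>?b s\<close> by (auto simp: Inv_def s)
    from axes(1) p show ?thesis
    proof (cases rule: trace_step_cases)
      case (minor c)
      have "decrease c p w = p w"
        using minor(1) axes by (auto simp: decrease_def)
      then have "Inv (?c s)"
        using minor Bs hit by (auto simp: Inv_def s Let_def)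
      then show ?thesis
        using measure minor by (simp add: s Let_def)
    next
      case major
      \<comment> \<open>The step adds just the level \<open>p w\<close> to the claim, and
        \<open>p\<close>, where the trace leaves this level, is its witness.\<close>
      have "\<exists>A\<in>set Bs. A w = q w \<and> A \<le> q" if q: "q \<in> C" "decrease w p w < q w" for q
      proof (cases "p w < q w")
        case True
        then show ?thesis using hit q by blast
      next
        case False
        then have "q w = p w"
          using q(2) by (simp add: decrease_def)
        then have "p \<le> q"
          using stuck_point_le[OF axes(1) p(1) q(1)] major by blast
        then show ?thesis
          using Bs(2) \<open>q w = p w\<close> by auto
      qed
      then have "Inv (?c s)"
        using major Bs by (auto simp: Inv_def s Let_def)
      then show ?thesis
        using measure major by (simp add: s Let_def)
    qed
  qed
  obtain t where t: "while_option ?b ?c (max_point C, [max_point C]) = Some t"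
    using measure_while_option_Some[where P = Inv and f = f, OF step init] by blast
  then have "Inv t" "\<not> ?b t"
    using while_option_rule[where P = Inv, OF _ t init] step while_option_stop[OF t] by blast+
  then obtain Bs where run: "while_option ?b ?c (max_point C, [max_point C]) = Some (origin, Bs)"
    and inv: "Inv (origin, Bs)"
    using t by (cases t) auto
  \<comment> \<open>The final invariant covers the positive levels; level 0 is witnessed by the
    recorded origin.\<close>
  have "\<exists>A\<in>set Bs. A w = q w \<and> A \<le> q" if "q \<in> C" for q
  proof (cases "0 < q w")
    case True
    then show ?thesis using inv that by (simp add: Inv_def)
  next
    case False
    then have "q w = 0"
      using origin_le[OF that] by (simp add: le_fun_def order_antisym)
    then show ?thesis
      using inv origin_le[OF that] by (force simp: Inv_def)
  qed
  moreover have "boundary_trace C u v w (max_point C) = Some Bs"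
    unfolding boundary_trace_def run by simp
  moreover have "set Bs \<subseteq> C"
    using inv by (simp add: Inv_def)
  ultimately show thesis
    using that by blast
qed

end

section \<open>Points of the staircase as joins of three trace points\<close>

theorem theorem2:
  fixes n :: nat and C :: "point set"
  assumes "staircase n C"
  shows "\<exists>BX BY BZ.
           boundary_trace C X Y Z (max_point C) = Some BZ \<and>
           boundary_trace C Y Z X (max_point C) = Some BX \<and>
           boundary_trace C Z X Y (max_point C) = Some BY \<and>
           C = join3 BX BY BZ"
proof -
  obtain lo hi where "regular_sequence n lo hi C"
    using assms by (auto simp: staircase_def regular_sequence_def)
  then interpret regular_sequence n lo hi C .
  have axes: "{X, Y, Z} = UNIV" "{Y, Z, X} = UNIV" "{Z, X, Y} = UNIV"
    using axis.exhaust by blast+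
  obtain BZ where BZ: "boundary_trace C X Y Z (max_point C) = Some BZ" "set BZ \<subseteq> C"
    "\<And>q. q \<in> C \<Longrightarrow> \<exists>A\<in>set BZ. A Z = q Z \<and> A \<le> q"
    using boundary_trace_level_points[OF axes(1)] by auto
  obtain BX where BX: "boundary_trace C Y Z X (max_point C) = Some BX" "set BX \<subseteq> C"
    "\<And>q. q \<in> C \<Longrightarrow> \<exists>A\<in>set BX. A X = q X \<and> A \<le> q"
    using boundary_trace_level_points[OF axes(2)] by auto
  obtain BY where BY: "boundary_trace C Z X Y (max_point C) = Some BY" "set BY \<subseteq> C"
    "\<And>q. q \<in> C \<Longrightarrow> \<exists>A\<in>set BY. A Y = q Y \<and> A \<le> q"
    using boundary_trace_level_points[OF axes(3)] by auto
  have "q \<in> join3 BX BY BZ" if q: "q \<in> C" for q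
  proof -
    obtain A1 A2 A3 where A: "A1 \<in> set BX" "A1 X = q X" "A1 \<le> q"
      "A2 \<in> set BY" "A2 Y = q Y" "A2 \<le> q" "A3 \<in> set BZ" "A3 Z = q Z" "A3 \<le> q"
      using BX(3)[OF q] BY(3)[OF q] BZ(3)[OF q] by blast
    \<comment> \<open>Each axis is the last one in exactly one search order, so one of the three
      points attains \<open>q c\<close>.\<close>
    have "q c \<le> sup (sup A1 A2) A3 c" for c
      using A by (cases c) (auto simp: sup_int_def)
    then have "q = sup (sup A1 A2) A3"
      using A by (intro order_antisym) (auto simp: le_fun_def)
    then show ?thesis
      using A unfolding join3_def by blast
  qed
  moreover have "join3 BX BY BZ \<subseteq> C"
    unfolding join3_def using BX(2) BY(2) BZ(2) lattice_closed(2) by blast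
  ultimately show ?thesis
    using BX(1) BY(1) BZ(1) by blast
qed

end
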